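(* Let $\mathbf P=(P,\le,0)$ be a poset with least element $0$ and let $f,g\colon P\to P$ be monotone and orthogonally adjoint. Then there exist monotone mappings $\overline f,\overline g\colon \mathrm{Id}(\mathbf P)\to \mathrm{Id}(\mathbf P)$ that are orthogonally adjoint in $(\mathrm{Id}(\mathbf P),\subseteq)$ and extend $f$ and $g$, respectively, i.e. $\overline f(I(a))=I(f(a))$ and $\overline g(I(a))=I(g(a))$ for all $a\in P$.
   Context: An ideal of a poset $\mathbf P=(P,\le,0)$ with least element $0$ is a downward closed non-empty subset of $P$. $\mathrm{Id}(\mathbf P)$ is the set of all ideals of $\mathbf P$; ordered by inclusion it is a complete lattice (with unions as joins and intersections as meets) with least element $\{0\}$. $I(a):=\{x\in P\mid x\le a\}$ is the principal ideal of $a$, and $\mathbf P$ is embedded in $(\mathrm{Id}(\mathbf P),\subseteq)$ by $x\mapsto I(x)$. In a poset with least element $0$, $x\wedge y=0$ means that the infimum of $x,y$ exists and equals $0$. Mappings $f,g\colon Q\to Q$ on a poset $(Q,\le,0)$ with least element $0$ are orthogonally adjoint if for all $x,y\in Q$: $f(x)\wedge y=0$ if and only if $x\wedge g(y)=0$. *)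

theory Defs
  imports "HOL-Algebra.Lattice"
begin

text \<open>Only meaningful for orders that have a least element: otherwise \<open>\<bottom>\<close> is unspecified.\<close>

definition disjoint_elems :: "('a, 'b) gorder_scheme \<Rightarrow> 'a \<Rightarrow> 'a \<Rightarrow> bool" where
  "disjoint_elems L x y \<longleftrightarrow> is_glb L \<bottom>\<^bsub>L\<^esub> {x, y}"

definition orthogonally_adjoint ::
  "('a, 'b) gorder_scheme \<Rightarrow> ('a \<Rightarrow> 'a) \<Rightarrow> ('a \<Rightarrow> 'a) \<Rightarrow> bool" where
  "orthogonally_adjoint L f g \<longleftrightarrow>
     (\<forall>x\<in>carrier L. \<forall>y\<in>carrier L. disjoint_elems L (f x) y \<longleftrightarrow> disjoint_elems L x (g y))"

text \<open>Ideals are not required to be directed.\<close>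

definition poset_ideal :: "('a, 'b) gorder_scheme \<Rightarrow> 'a set \<Rightarrow> bool" where
  "poset_ideal L A \<longleftrightarrow> A \<subseteq> carrier L \<and> A \<noteq> {} \<and>
     (\<forall>a\<in>A. \<forall>x\<in>carrier L. x \<sqsubseteq>\<^bsub>L\<^esub> a \<longrightarrow> x \<in> A)"

definition principal_ideal :: "('a, 'b) gorder_scheme \<Rightarrow> 'a \<Rightarrow> 'a set" where
  "principal_ideal L a = {x \<in> carrier L. x \<sqsubseteq>\<^bsub>L\<^esub> a}"

definition ideal_order :: "('a, 'b) gorder_scheme \<Rightarrow> 'a set gorder" where
  "ideal_order L = \<lparr>carrier = {A. poset_ideal L A}, eq = (=), le = (\<subseteq>)\<rparr>"

lemma partial_order_ideal_order: "partial_order (ideal_order L)"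
  by unfold_locales (auto simp: ideal_order_def)

lemma bottom_eq_least:
  assumes "partial_order L" and "least L z (carrier L)"
  shows "\<bottom>\<^bsub>L\<^esub> = z"
  unfolding bottom_def using assms
  by (intro some_equality) (auto simp: least_def intro: partial_order.le_antisym)

lemma bottom_ideal_order:
  assumes "partial_order L" and "\<exists>z. least L z (carrier L)"
  shows "\<bottom>\<^bsub>ideal_order L\<^esub> = {\<bottom>\<^bsub>L\<^esub>}"
proof -
  from assms(2) obtain z where z: "least L z (carrier L)" by blast
  have "least (ideal_order L) {z} (carrier (ideal_order L))"
    using z unfolding least_def ideal_order_def poset_ideal_def
    by (auto intro: partial_order.le_antisym[OF assms(1)])
  then have "\<bottom>\<^bsub>ideal_order L\<^esub> = {z}"
    by (rule bottom_eq_least[OF partial_order_ideal_order])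
  with bottom_eq_least[OF assms(1) z] show ?thesis by simp
qed

end

theory Submission
  imports Defs
begin

text \<open>The extension of \<open>f\<close> sends an ideal \<open>A\<close> to the ideal generated by \<open>f ` A\<close>. Two ideals are
  disjoint iff their elements are pairwise disjoint, and since every element of the generated ideal
  lies below some \<open>f a\<close>, orthogonal adjointness can be checked elementwise.\<close>

text \<open>Building the generated ideal as a union of principal ideals makes downward closure and
  monotonicity in \<open>A\<close> visible from the shape of the definition.\<close>

definition ideal_extension :: "('a, 'b) gorder_scheme \<Rightarrow> ('a \<Rightarrow> 'a) \<Rightarrow> 'a set \<Rightarrow> 'a set" where
  "ideal_extension L f A = (\<Union>a\<in>A. principal_ideal L (f a))"

lemma least_bottom:
  assumes "partial_order L" and "\<exists>z. least L z (carrier L)"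
  shows "least L \<bottom>\<^bsub>L\<^esub> (carrier L)"
  using assms bottom_eq_least by metis

text \<open>The least element is a lower bound of every pair, so being the infimum only asks that
  each common lower bound lie below it, which antisymmetry turns into equality. \<open>L\<close>
  stays generic so that the criterion applies to the ideals as well as to their elements.\<close>

lemma disjoint_elems_iff:
  assumes "partial_order L" and "\<exists>z. least L z (carrier L)"
    and "x \<in> carrier L" and "y \<in> carrier L"
  shows "disjoint_elems L x y \<longleftrightarrow>
    (\<forall>z\<in>carrier L. z \<sqsubseteq>\<^bsub>L\<^esub> x \<longrightarrow> z \<sqsubseteq>\<^bsub>L\<^esub> y \<longrightarrow> z = \<bottom>\<^bsub>L\<^esub>)"
proof -
  interpret partial_order L by fact
  note bot = least_bottom[OF assms(1,2)]
  then have bot_closed: "\<bottom>\<^bsub>L\<^esub> \<in> carrier L" and bot_le: "\<And>z. z \<in> carrier L \<Longrightarrow> \<bottom>\<^bsub>L\<^esub> \<sqsubseteq>\<^bsub>L\<^esub> z"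
    by (auto simp: least_def)
  have "is_glb L \<bottom>\<^bsub>L\<^esub> {x, y} \<longleftrightarrow>
      (\<forall>z\<in>carrier L. z \<sqsubseteq>\<^bsub>L\<^esub> x \<longrightarrow> z \<sqsubseteq>\<^bsub>L\<^esub> y \<longrightarrow> z \<sqsubseteq>\<^bsub>L\<^esub> \<bottom>\<^bsub>L\<^esub>)"
    unfolding greatest_def Lower_def using assms(3,4) bot_closed bot_le by auto
  moreover have "z \<sqsubseteq>\<^bsub>L\<^esub> \<bottom>\<^bsub>L\<^esub> \<longleftrightarrow> z = \<bottom>\<^bsub>L\<^esub>" if "z \<in> carrier L" for z
    using that bot_closed bot_le le_antisym by metis
  ultimately show ?thesis
    unfolding disjoint_elems_def by (metis (no_types))
qed

text \<open>Both ideals contain \<open>\<bottom>\<close>, so \<open>A \<inter> B\<close> is itself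
  an ideal and the largest common lower bound of \<open>A\<close> and \<open>B\<close>. Testing all
  common lower bounds thus collapses to testing this one.\<close>

lemma disjoint_ideals_iff:
  assumes "partial_order L" and "\<exists>z. least L z (carrier L)"
    and A: "poset_ideal L A" and B: "poset_ideal L B"
  shows "disjoint_elems (ideal_order L) A B \<longleftrightarrow> A \<inter> B = {\<bottom>\<^bsub>L\<^esub>}"
proof -
  interpret partial_order L by fact
  have "\<bottom>\<^bsub>L\<^esub> \<in> A" "\<bottom>\<^bsub>L\<^esub> \<in> B"
    using A B least_bottom[OF assms(1,2)] unfolding poset_ideal_def least_def by auto
  then have "poset_ideal L (A \<inter> B)"
    using A B unfolding poset_ideal_def by blast
  \<comment> \<open>Ideals are non-empty, so the empty set is excluded here.\<close>
  moreover have "C = {\<bottom>\<^bsub>L\<^esub>}" if "poset_ideal L C" "C \<subseteq> {\<bottom>\<^bsub>L\<^esub>}" for C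
    using that unfolding poset_ideal_def by blast
  \<comment> \<open>This is what allows \<open>disjoint_elems_iff\<close> to be instantiated with
    \<open>ideal_order L\<close> in the final step.\<close>
  moreover have "\<exists>Z. least (ideal_order L) Z (carrier (ideal_order L))"
  proof
    show "least (ideal_order L) {\<bottom>\<^bsub>L\<^esub>} (carrier (ideal_order L))"
      using least_bottom[OF assms(1,2)] unfolding least_def ideal_order_def poset_ideal_def
      by (auto intro: le_antisym)
  qed
  ultimately show ?thesis
    using A B \<open>\<bottom>\<^bsub>L\<^esub> \<in> A\<close> \<open>\<bottom>\<^bsub>L\<^esub> \<in> B\<close>
    by (subst disjoint_elems_iff[OF partial_order_ideal_order])
      (auto simp: ideal_order_def bottom_ideal_order[OF assms(1,2), unfolded ideal_order_def])
qed

text \<open>A common lower bound of \<open>a\<close> and \<open>b\<close> lies in both ideals by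
  downward closure. Conversely, an element of the intersection is a common lower bound of itself,
  taken once from each ideal.\<close>

lemma disjoint_ideals_iff_elems:
  assumes "partial_order L" and "\<exists>z. least L z (carrier L)"
    and A: "poset_ideal L A" and B: "poset_ideal L B"
  shows "disjoint_elems (ideal_order L) A B \<longleftrightarrow> (\<forall>a\<in>A. \<forall>b\<in>B. disjoint_elems L a b)"
proof -
  interpret partial_order L by fact
  have bot: "\<bottom>\<^bsub>L\<^esub> \<in> A \<inter> B"
    using A B least_bottom[OF assms(1,2)] unfolding poset_ideal_def least_def by auto
  have "A \<subseteq> carrier L" "B \<subseteq> carrier L"
    using A B unfolding poset_ideal_def by auto
  have "A \<inter> B = {\<bottom>\<^bsub>L\<^esub>} \<longleftrightarrow>
      (\<forall>a\<in>A. \<forall>b\<in>B. \<forall>z\<in>carrier L. z \<sqsubseteq>\<^bsub>L\<^esub> a \<longrightarrow> z \<sqsubseteq>\<^bsub>L\<^esub> b \<longrightarrow> z = \<bottom>\<^bsub>L\<^esub>)"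
    (is "_ \<longleftrightarrow> ?R")
  proof
    assume *: "A \<inter> B = {\<bottom>\<^bsub>L\<^esub>}"
    show ?R
    proof (intro ballI impI)
      fix a b z
      assume "a \<in> A" "b \<in> B" "z \<in> carrier L" "z \<sqsubseteq>\<^bsub>L\<^esub> a" "z \<sqsubseteq>\<^bsub>L\<^esub> b"
      then have "z \<in> A \<inter> B"
        using A B by (auto simp: poset_ideal_def)
      with * show "z = \<bottom>\<^bsub>L\<^esub>" by simp
    qed
  next
    assume R: ?R
    have "z = \<bottom>\<^bsub>L\<^esub>" if "z \<in> A \<inter> B" for z
    proof -
      have "z \<in> A" "z \<in> B" "z \<in> carrier L"
        using that \<open>A \<subseteq> carrier L\<close> by auto
      \<comment> \<open>Instantiate \<open>?R\<close> with both \<open>a\<close> and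
        \<open>b\<close> equal to \<open>z\<close>.\<close>
      with R le_refl show ?thesis by blast
    qed
    with bot show "A \<inter> B = {\<bottom>\<^bsub>L\<^esub>}" by blast
  qed
  also have "\<dots> \<longleftrightarrow> (\<forall>a\<in>A. \<forall>b\<in>B. disjoint_elems L a b)"
    using \<open>A \<subseteq> carrier L\<close> \<open>B \<subseteq> carrier L\<close>
    by (intro ball_cong refl disjoint_elems_iff[OF assms(1,2), symmetric]) auto
  finally show ?thesis
    using disjoint_ideals_iff[OF assms] by simp
qed

lemma disjoint_elems_commute: "disjoint_elems L x y \<longleftrightarrow> disjoint_elems L y x"
  by (simp add: disjoint_elems_def insert_commute)

lemma image_mem_ideal_extension:
  assumes "partial_order L" and "f a \<in> carrier L" and "a \<in> A"
  shows "f a \<in> ideal_extension L f A"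
proof -
  interpret partial_order L by fact
  show ?thesis
    using le_refl[OF assms(2)] assms(2,3)
    by (auto simp: ideal_extension_def principal_ideal_def)
qed

lemma poset_ideal_ideal_extension:
  assumes "partial_order L" and "f \<in> carrier L \<rightarrow> carrier L" and "poset_ideal L A"
  shows "poset_ideal L (ideal_extension L f A)"
proof -
  interpret partial_order L by fact
  have f_closed: "f a \<in> carrier L" if "a \<in> A" for a
    using that assms(2,3) by (auto simp: poset_ideal_def)
  obtain a where "a \<in> A"
    using assms(3) by (auto simp: poset_ideal_def)
  then have "f a \<in> ideal_extension L f A"
    by (intro image_mem_ideal_extension assms(1) f_closed)
  moreover have "ideal_extension L f A \<subseteq> carrier L"
    by (auto simp: ideal_extension_def principal_ideal_def)
  moreover have "x \<in> ideal_extension L f A"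
    if y: "y \<in> ideal_extension L f A" and x: "x \<in> carrier L" "x \<sqsubseteq>\<^bsub>L\<^esub> y" for x y
  proof -
    obtain a where a: "a \<in> A" "y \<in> carrier L" "y \<sqsubseteq>\<^bsub>L\<^esub> f a"
      using y by (auto simp: ideal_extension_def principal_ideal_def)
    with x le_trans[of x y "f a"] f_closed have "x \<sqsubseteq>\<^bsub>L\<^esub> f a"
      by simp
    with a x show ?thesis
      by (auto simp: ideal_extension_def principal_ideal_def)
  qed
  ultimately show ?thesis
    unfolding poset_ideal_def by blast
qed

text \<open>Enlarging \<open>A\<close> only adds members to the union.\<close>

lemma isotone_ideal_extension: "isotone (ideal_order L) (ideal_order L) (ideal_extension L f)"
proof -
  interpret partial_order "ideal_order L" by (rule partial_order_ideal_order)
  show ?thesis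
    by (intro isotoneI weak_partial_order_axioms) (auto simp: ideal_order_def ideal_extension_def)
qed

text \<open>Monotonicity of \<open>f\<close> enters here: it puts \<open>f x\<close> below
  \<open>f a\<close> for every \<open>x\<close> below \<open>a\<close>, so the member of the union
  indexed by \<open>a\<close> itself absorbs all the others.\<close>

lemma ideal_extension_principal_ideal:
  assumes "partial_order L" and "f \<in> carrier L \<rightarrow> carrier L" and "isotone L L f"
    and "a \<in> carrier L"
  shows "ideal_extension L f (principal_ideal L a) = principal_ideal L (f a)"
proof -
  interpret partial_order L by fact
  have fa: "f a \<in> carrier L"
    using assms(2,4) by auto
  have "y \<sqsubseteq>\<^bsub>L\<^esub> f a"
    if "x \<in> carrier L" "x \<sqsubseteq>\<^bsub>L\<^esub> a" "y \<in> carrier L" "y \<sqsubseteq>\<^bsub>L\<^esub> f x" for x y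
  proof (rule le_trans)
    show "f x \<sqsubseteq>\<^bsub>L\<^esub> f a"
      using that assms(3,4) by (auto simp: isotone_def)
  qed (use that assms(2) fa in auto)
  then show ?thesis
    using assms(4) le_refl[OF assms(4)] by (auto simp: ideal_extension_def principal_ideal_def)
qed

text \<open>Reduces disjointness from the generated ideal to its generators: each \<open>f a\<close>
  belongs to that ideal, and every other element lies below some \<open>f a\<close>.\<close>

lemma disjoint_ideal_extension_iff:
  assumes "partial_order L" and "\<exists>z. least L z (carrier L)" and f: "f \<in> carrier L \<rightarrow> carrier L"
    and A: "poset_ideal L A" and B: "poset_ideal L B"
  shows "disjoint_elems (ideal_order L) (ideal_extension L f A) B \<longleftrightarrow>
    (\<forall>a\<in>A. \<forall>b\<in>B. disjoint_elems L (f a) b)"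
proof -
  interpret partial_order L by fact
  have sub: "A \<subseteq> carrier L" "B \<subseteq> carrier L"
    using A B unfolding poset_ideal_def by auto
  \<comment> \<open>Disjointness from \<open>b\<close> is inherited by smaller elements, since a
    common lower bound of \<open>x\<close> and \<open>b\<close> is also one of \<open>f a\<close>
    and \<open>b\<close>.\<close>
  have "disjoint_elems L x b"
    if "a \<in> A" "b \<in> B" "x \<in> carrier L" "x \<sqsubseteq>\<^bsub>L\<^esub> f a" "disjoint_elems L (f a) b" for a b x
  proof -
    have "f a \<in> carrier L" "b \<in> carrier L"
      using sub f that by auto
    then show ?thesis
      using that(3-5) by (auto simp: disjoint_elems_iff[OF assms(1,2)] intro: le_trans)
  qed
  moreover have "f a \<in> ideal_extension L f A" if "a \<in> A" for a
    using that sub f by (intro image_mem_ideal_extension assms(1)) auto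
  ultimately show ?thesis
    using disjoint_ideals_iff_elems[OF assms(1,2) poset_ideal_ideal_extension[OF assms(1) f A] B]
    by (auto simp: ideal_extension_def principal_ideal_def)
qed

lemma orthogonally_adjoint_ideal_extension:
  assumes "partial_order L" and "\<exists>z. least L z (carrier L)"
    and "f \<in> carrier L \<rightarrow> carrier L" and "g \<in> carrier L \<rightarrow> carrier L"
    and "orthogonally_adjoint L f g"
  shows "orthogonally_adjoint (ideal_order L) (ideal_extension L f) (ideal_extension L g)"
  unfolding orthogonally_adjoint_def
proof (intro ballI)
  fix A B
  assume "A \<in> carrier (ideal_order L)" "B \<in> carrier (ideal_order L)"
  then have A: "poset_ideal L A" and B: "poset_ideal L B"
    by (auto simp: ideal_order_def)
  have "disjoint_elems (ideal_order L) (ideal_extension L f A) B \<longleftrightarrow>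
      (\<forall>a\<in>A. \<forall>b\<in>B. disjoint_elems L (f a) b)"
    using assms(1-3) A B by (rule disjoint_ideal_extension_iff)
  \<comment> \<open>Adjointness is applied to each pair separately. Symmetry of disjointness then
    moves \<open>g b\<close> to the first argument, so that the criterion used for \<open>f\<close>
    and \<open>A\<close> serves again for \<open>g\<close> and \<open>B\<close>.\<close>
  also have "\<dots> \<longleftrightarrow> (\<forall>b\<in>B. \<forall>a\<in>A. disjoint_elems L (g b) a)"
    using assms(5) A B unfolding orthogonally_adjoint_def poset_ideal_def
    by (meson disjoint_elems_commute subsetD)
  also have "\<dots> \<longleftrightarrow> disjoint_elems (ideal_order L) (ideal_extension L g B) A"
    using assms(1,2,4) B A by (rule disjoint_ideal_extension_iff[symmetric])
  finally show "disjoint_elems (ideal_order L) (ideal_extension L f A) B \<longleftrightarrow>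
      disjoint_elems (ideal_order L) A (ideal_extension L g B)"
    by (simp only: disjoint_elems_commute)
qed

theorem theorem25:
  fixes P :: "('a, 'b) gorder_scheme" and f g :: "'a \<Rightarrow> 'a"
  assumes "partial_order P" and "\<exists>z. least P z (carrier P)"
    and "f \<in> carrier P \<rightarrow> carrier P" and "g \<in> carrier P \<rightarrow> carrier P"
    and "isotone P P f" and "isotone P P g"
    and "orthogonally_adjoint P f g"
  shows "\<exists>f' g'.
      f' \<in> carrier (ideal_order P) \<rightarrow> carrier (ideal_order P) \<and>
      g' \<in> carrier (ideal_order P) \<rightarrow> carrier (ideal_order P) \<and>
      isotone (ideal_order P) (ideal_order P) f' \<and>
      isotone (ideal_order P) (ideal_order P) g' \<and>
      orthogonally_adjoint (ideal_order P) f' g' \<and>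
      (\<forall>a\<in>carrier P. f' (principal_ideal P a) = principal_ideal P (f a)) \<and>
      (\<forall>a\<in>carrier P. g' (principal_ideal P a) = principal_ideal P (g a))"
proof (intro exI conjI ballI)
  \<comment> \<open>The witnesses left schematic by \<open>exI\<close> are fixed by these two
    closure goals, and the remaining conjuncts follow for the same maps.\<close>
  show "ideal_extension P f \<in> carrier (ideal_order P) \<rightarrow> carrier (ideal_order P)"
    using assms by (simp add: ideal_order_def poset_ideal_ideal_extension)
  show "ideal_extension P g \<in> carrier (ideal_order P) \<rightarrow> carrier (ideal_order P)"
    using assms by (simp add: ideal_order_def poset_ideal_ideal_extension)
qed (use assms in \<open>simp_all add: isotone_ideal_extension orthogonally_adjoint_ideal_extension
    ideal_extension_principal_ideal\<close>)

end
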